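(* There exists an infinite family of graphs $G$ (with $|V(G)|$ unbounded) such that the nondeterministic communication complexity of the clique vs. independent set problem on $G$ is at least $(2-o(1))\log_2|V(G)|$; that is, there are graphs $G_1,G_2,\dots$ with $|V(G_t)|\to\infty$ and a function $\varepsilon$ with $\varepsilon(t)\to0$ such that this complexity for $G_t$ is at least $(2-\varepsilon(t))\log_2|V(G_t)|$.
   Context: For a graph $G$, in the clique vs. independent set problem Alice receives a clique $C$ of $G$ and Bob receives an independent set $I$ of $G$ (so $|C\cap I|\le 1$), and they must decide whether $C\cap I=\emptyset$. The nondeterministic communication complexity here refers to certifying the disjoint case: it is (up to rounding) $\log_2$ of the minimum number of combinatorial rectangles $\mathcal{A}\times\mathcal{I}$ ($\mathcal{A}$ a set of cliques, $\mathcal{I}$ a set of independent sets, with $C\cap I=\emptyset$ for all $C\in\mathcal{A}, I\in\mathcal{I}$) needed to cover all pairs $(C,I)$ with $C\cap I=\emptyset$. *)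

theory Defs
  imports Complex_Main "HOL-Library.Ramsey"
begin

definition fin_sgraph :: "'a set \<Rightarrow> 'a set set \<Rightarrow> bool" where
  "fin_sgraph V E \<longleftrightarrow> finite V \<and> E \<subseteq> [V]\<^bsup>2\<^esup>"

definition cliques :: "'a set \<Rightarrow> 'a set set \<Rightarrow> 'a set set" where
  "cliques V E = {C. C \<subseteq> V \<and> clique C E}"

definition indep_sets :: "'a set \<Rightarrow> 'a set set \<Rightarrow> 'a set set" where
  "indep_sets V E = {I. I \<subseteq> V \<and> indep I E}"

text \<open>A pair \<open>(A, B)\<close> stands for the combinatorial rectangle \<open>A \<times> B\<close>.\<close>

definition disjointness_cover ::
    "'a set \<Rightarrow> 'a set set \<Rightarrow> ('a set set \<times> 'a set set) set \<Rightarrow> bool" where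
  "disjointness_cover V E R \<longleftrightarrow>
     finite R \<and>
     (\<forall>(A, B) \<in> R. A \<subseteq> cliques V E \<and> B \<subseteq> indep_sets V E \<and> (\<forall>C\<in>A. \<forall>I\<in>B. C \<inter> I = {})) \<and>
     (\<forall>C \<in> cliques V E. \<forall>I \<in> indep_sets V E. C \<inter> I = {} \<longrightarrow> (\<exists>(A, B) \<in> R. C \<in> A \<and> I \<in> B))"

definition cis_cover_number :: "'a set \<Rightarrow> 'a set set \<Rightarrow> nat" where
  "cis_cover_number V E = (LEAST k. \<exists>R. disjointness_cover V E R \<and> card R = k)"

text \<open>No rounding to an integer is applied: this is at most the rounded-up cost, so a lower bound
  on it is also a lower bound on the number of certificate bits.\<close>

definition cis_nondet_cc :: "'a set \<Rightarrow> 'a set set \<Rightarrow> real" where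
  "cis_nondet_cc V E = log 2 (real (cis_cover_number V E))"

text \<open>The minimum is taken over a nonempty set.\<close>

lemma disjointness_cover_exists:
  assumes "fin_sgraph V E"
  shows "\<exists>R. disjointness_cover V E R"
proof -
  have "finite V" using assms by (simp add: fin_sgraph_def)
  then have fin: "finite (cliques V E)" "finite (indep_sets V E)"
    by (auto simp: cliques_def indep_sets_def)
  define P where "P = {(C, I) \<in> cliques V E \<times> indep_sets V E. C \<inter> I = {}}"
  have "finite P"
    by (rule finite_subset[of _ "cliques V E \<times> indep_sets V E"]) (use fin in \<open>auto simp: P_def\<close>)
  then have "disjointness_cover V E ((\<lambda>(C, I). ({C}, {I})) ` P)"
    unfolding disjointness_cover_def by (fastforce simp: P_def)
  then show ?thesis ..
qed

lemma cis_cover_number_attained: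
  assumes "fin_sgraph V E"
  shows "\<exists>R. disjointness_cover V E R \<and> card R = cis_cover_number V E"
  unfolding cis_cover_number_def
  by (rule LeastI_ex) (use disjointness_cover_exists[OF assms] in blast)

end

theory Submission
  imports Defs "HOL-Real_Asymp.Real_Asymp"
begin

text \<open>
  If \<open>C v\<close> and \<open>I v\<close> are disjoint for every \<open>v \<in> W\<close>, if \<open>C u\<close> and \<open>I v\<close> always meet in at most one
  point, and if for \<open>u \<noteq> v\<close> at least one of \<open>C u \<inter> I v\<close>, \<open>C v \<inter> I u\<close> is nonempty, then making each
  \<open>C v\<close> a clique leaves each \<open>I v\<close> independent, and the pairs \<open>(C v, I v)\<close> form a fooling set: no two
  of them lie in a common rectangle. So \<open>card W\<close> rectangles are needed (this is the ordered biclique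
  partition method of Shigeta and Amano).

  Take for \<open>W\<close> the words of length \<open>2r - 1\<close> over \<open>k\<close> letters. Two words are compared through the set
  \<open>D\<close> of positions where they differ. Suppose a family of intervals \<open>{D. P \<subseteq> D \<and> Z \<inter> D = {}}\<close> with
  \<open>card (Z \<union> P) \<le> r\<close> covers all nonempty \<open>D\<close>, each interval having a sign and a label in \<open>P\<close>, such
  that two intervals which meet have the same label and opposite signs. The graph vertices are the
  restrictions of words to \<open>Z \<union> P\<close>, for all intervals; such a vertex lies in \<open>C u\<close> if \<open>u\<close> extends it,
  and in \<open>I v\<close> if \<open>v\<close> agrees with it on \<open>Z\<close>, differs from it everywhere on \<open>P\<close>, and is larger or
  smaller at the label according to the sign. There are only \<open>O(r\<^sup>2 k\<^sup>r)\<close> vertices for \<open>k\<^bsup>2r-1\<^esup>\<close> words.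

  The intervals with positive sign are: \<open>p \<in> D\<close>, and the \<open>r - 1\<close> positions cyclically following \<open>p\<close>
  are not in \<open>D\<close>. Those with negative sign are leaves of a decision tree of depth \<open>r\<close>: query
  \<open>r - 1, r - 2, \<dots>, 1\<close> until some \<open>t \<in> D\<close> is found, then query \<open>t + r - 1, \<dots>, r\<close> until some
  \<open>p \<in> D\<close> is found. If one of the searches fails, \<open>D\<close> is empty or in an interval with positive sign.
\<close>

section \<open>Fooling sets and the cover number\<close>

lemma cis_cover_number_ge_fooling_set:
  fixes C I :: "'w \<Rightarrow> 'a set"
  assumes "finite V"
    and CV: "\<And>v. v \<in> W \<Longrightarrow> C v \<subseteq> V" and IV: "\<And>v. v \<in> W \<Longrightarrow> I v \<subseteq> V"
    and disj: "\<And>v. v \<in> W \<Longrightarrow> C v \<inter> I v = {}"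
    and once: "\<And>u v i j. u \<in> W \<Longrightarrow> v \<in> W \<Longrightarrow> i \<in> C u \<inter> I v \<Longrightarrow> j \<in> C u \<inter> I v \<Longrightarrow> i = j"
    and meet: "\<And>u v. u \<in> W \<Longrightarrow> v \<in> W \<Longrightarrow> u \<noteq> v \<Longrightarrow> C u \<inter> I v \<noteq> {} \<or> C v \<inter> I u \<noteq> {}"
  shows "\<exists>E. fin_sgraph V E \<and> card W \<le> cis_cover_number V E"
proof -
  define E where "E = {{i, j} | i j. i \<noteq> j \<and> (\<exists>v\<in>W. i \<in> C v \<and> j \<in> C v)}"
  have graph: "fin_sgraph V E"
    unfolding fin_sgraph_def E_def using \<open>finite V\<close> CV by (fastforce simp: nsets_def)
  have cl: "C v \<in> cliques V E" if "v \<in> W" for v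
    using that CV by (auto simp: cliques_def clique_def E_def)
  have ind: "I v \<in> indep_sets V E" if "v \<in> W" for v
  proof -
    have "{i, j} \<notin> E" if "i \<in> I v" "j \<in> I v" "i \<noteq> j" for i j
    proof
      assume "{i, j} \<in> E"
      then obtain u where "u \<in> W" "i \<in> C u" "j \<in> C u"
        by (auto simp: E_def doubleton_eq_iff)
      then show False using once[of u v i j] that \<open>v \<in> W\<close> by auto
    qed
    then show ?thesis using that IV by (auto simp: indep_sets_def indep_def)
  qed
  obtain R where R: "disjointness_cover V E R" and cardR: "card R = cis_cover_number V E"
    using cis_cover_number_attained[OF graph] by blast
  have "\<forall>v\<in>W. \<exists>r\<in>R. C v \<in> fst r \<and> I v \<in> snd r"
    using R cl ind disj unfolding disjointness_cover_def by fastforce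
  then obtain \<rho> where \<rho>: "\<And>v. v \<in> W \<Longrightarrow> \<rho> v \<in> R \<and> C v \<in> fst (\<rho> v) \<and> I v \<in> snd (\<rho> v)"
    by metis
  have rect: "A \<inter> B = {}" if "r \<in> R" "A \<in> fst r" "B \<in> snd r" for r A B
    using R that unfolding disjointness_cover_def by fastforce
  have "inj_on \<rho> W"
  proof (rule inj_onI, rule ccontr)
    fix u v assume "u \<in> W" "v \<in> W" "\<rho> u = \<rho> v" "u \<noteq> v"
    then show False
      using meet[of u v] rect[of "\<rho> u" "C u" "I v"] rect[of "\<rho> u" "C v" "I u"] \<rho>[of u] \<rho>[of v] by auto
  qed
  moreover have "\<rho> ` W \<subseteq> R" using \<rho> by auto
  moreover have "finite R" using R by (simp add: disjointness_cover_def)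
  ultimately have "card W \<le> card R" by (metis card_inj_on_le)
  with graph cardR show ?thesis by auto
qed

section \<open>From signed intervals to a fooling set of words\<close>

lemma cis_cover_number_ge_signed_cubes:
  fixes F :: "'c set" and Z P :: "'c \<Rightarrow> nat set" and label :: "'c \<Rightarrow> nat" and pos :: "'c \<Rightarrow> bool"
  assumes "finite F"
    and dom: "\<And>c. c \<in> F \<Longrightarrow> Z c \<union> P c \<subseteq> {..<d}"
    and codim: "\<And>c. c \<in> F \<Longrightarrow> card (Z c \<union> P c) \<le> r"
    and label: "\<And>c. c \<in> F \<Longrightarrow> label c \<in> P c"
    and cover: "\<And>D. D \<subseteq> {..<d} \<Longrightarrow> D \<noteq> {} \<Longrightarrow> \<exists>c\<in>F. P c \<subseteq> D \<and> Z c \<inter> D = {}"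
    and unamb: "\<And>c c' D. \<lbrakk>c \<in> F; c' \<in> F; c \<noteq> c'; P c \<union> P c' \<subseteq> D; (Z c \<union> Z c') \<inter> D = {}\<rbrakk>
                  \<Longrightarrow> label c = label c' \<and> pos c \<noteq> pos c'"
    and "0 < k" and M: "card F * k ^ r \<le> M"
  shows "\<exists>E. fin_sgraph {..<M} E \<and> k ^ d \<le> cis_cover_number {..<M} E"
proof -
  define W where "W = {..<d} \<rightarrow>\<^sub>E {..<k}"
  define T where "T c = Z c \<union> P c" for c
  define X where "X = (SIGMA c:F. T c \<rightarrow>\<^sub>E {..<k})"
  define C where "C u = (\<lambda>c. (c, restrict u (T c))) ` F" for u :: "nat \<Rightarrow> nat"
  define I where "I v = {(c, a) \<in> X. (\<forall>i\<in>Z c. a i = v i) \<and> (\<forall>i\<in>P c. a i \<noteq> v i)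
      \<and> (pos c \<longleftrightarrow> a (label c) < v (label c))}" for v :: "nat \<Rightarrow> nat"
  have finT: "finite (T c)" if "c \<in> F" for c
    using dom[OF that] finite_subset unfolding T_def by blast
  have "finite X"
    unfolding X_def using \<open>finite F\<close> finT by (auto intro!: finite_PiE)
  have "card X = (\<Sum>c\<in>F. k ^ card (T c))"
    unfolding X_def using \<open>finite F\<close> finT
    by (subst card_SigmaI) (auto intro!: finite_PiE simp: card_PiE)
  also have "\<dots> \<le> (\<Sum>c\<in>F. k ^ r)"
    using codim \<open>0 < k\<close> by (intro sum_mono power_increasing) (auto simp: T_def)
  finally have "card X \<le> M" using M by simp
  \<comment> \<open>\<open>f\<close> renames the vertices as numbers; numbers below \<open>M\<close>
    outside its image only pad the vertex set to size exactly \<open>M\<close>.\<close>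
  then obtain f where f: "inj_on f X" "f ` X \<subseteq> {..<M}"
    using card_le_inj[of X "{..<M}"] \<open>finite X\<close> by auto
  have CX: "C u \<subseteq> X" if "u \<in> W" for u
    using that dom unfolding C_def X_def W_def T_def by (fastforce simp: PiE_iff)
  have IX: "I v \<subseteq> X" for v by (auto simp: I_def)
  have CI: "q \<in> C u \<inter> I v \<longleftrightarrow> (\<exists>c\<in>F. q = (c, restrict u (T c)) \<and> (\<forall>i\<in>Z c. u i = v i)
      \<and> (\<forall>i\<in>P c. u i \<noteq> v i) \<and> (pos c \<longleftrightarrow> u (label c) < v (label c)))" if "u \<in> W" for q u v
    using CX[OF that] label by (auto simp: C_def I_def T_def)
  have once: "q = q'" if uv: "u \<in> W" "q \<in> C u \<inter> I v" "q' \<in> C u \<inter> I v" for u v q q'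
  proof -
    obtain c where c: "c \<in> F" "q = (c, restrict u (T c))" "\<forall>i\<in>Z c. u i = v i" "\<forall>i\<in>P c. u i \<noteq> v i"
      "pos c \<longleftrightarrow> u (label c) < v (label c)" using uv CI by blast
    obtain c' where c': "c' \<in> F" "q' = (c', restrict u (T c'))" "\<forall>i\<in>Z c'. u i = v i"
      "\<forall>i\<in>P c'. u i \<noteq> v i" "pos c' \<longleftrightarrow> u (label c') < v (label c')" using uv CI by blast
    \<comment> \<open>Both intervals contain the set where \<open>u\<close> and \<open>v\<close>
      differ, so by \<open>unamb\<close> distinct ones would demand opposite comparisons at a common
      label.\<close>
    have "c = c'"
    proof (rule ccontr)
      assume "c \<noteq> c'"
      then have "label c = label c' \<and> pos c \<noteq> pos c'"
        using c c' by (intro unamb[where D = "{i. u i \<noteq> v i}"]) auto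
      then show False using c(5) c'(5) by metis
    qed
    then show ?thesis using c c' by simp
  qed
  have meet: "C u \<inter> I v \<noteq> {} \<or> C v \<inter> I u \<noteq> {}" if uv: "u \<in> W" "v \<in> W" "u \<noteq> v" for u v
  proof -
    define D where "D = {i\<in>{..<d}. u i \<noteq> v i}"
    have "D \<noteq> {}"
      using uv unfolding D_def W_def by (auto intro: PiE_ext)
    then obtain c where c: "c \<in> F" "P c \<subseteq> D" "Z c \<inter> D = {}"
      using cover[of D] unfolding D_def by blast
    have ne: "\<forall>i\<in>P c. u i \<noteq> v i" and eq: "\<forall>i\<in>Z c. u i = v i"
      using c dom[of c] by (auto simp: D_def)
    have "u (label c) \<noteq> v (label c)" using ne label c by blast
    \<comment> \<open>\<open>D\<close> is symmetric in \<open>u\<close> and \<open>v\<close>; the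
      comparison at the label decides which of the two intersections gets the vertex.\<close>
    then consider "pos c \<longleftrightarrow> u (label c) < v (label c)" | "pos c \<longleftrightarrow> v (label c) < u (label c)"
      by linarith
    then show ?thesis
    proof cases
      case 1
      then have "(c, restrict u (T c)) \<in> C u \<inter> I v" using CI[OF uv(1)] c ne eq by blast
      then show ?thesis by blast
    next
      case 2
      then have "(c, restrict v (T c)) \<in> C v \<inter> I u"
        unfolding CI[OF uv(2)] using c ne eq by (metis (no_types, lifting))
      then show ?thesis by blast
    qed
  qed
  have disj: "C v \<inter> I v = {}" if "v \<in> W" for v
    using CI[OF that] label by blast
  have im: "f ` C u \<inter> f ` I v = f ` (C u \<inter> I v)" if "u \<in> W" for u v
    using inj_on_image_Int[OF f(1) CX[OF that] IX] by simp
  have "\<exists>E. fin_sgraph {..<M} E \<and> card W \<le> cis_cover_number {..<M} E"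
  proof (rule cis_cover_number_ge_fooling_set[of _ W "\<lambda>v. f ` C v" "\<lambda>v. f ` I v"])
    show "i = j" if "u \<in> W" "v \<in> W" "i \<in> f ` C u \<inter> f ` I v" "j \<in> f ` C u \<inter> f ` I v" for u v i j
      using that once unfolding im[OF that(1)] by blast
    show "f ` C u \<inter> f ` I v \<noteq> {} \<or> f ` C v \<inter> f ` I u \<noteq> {}" if "u \<in> W" "v \<in> W" "u \<noteq> v" for u v
      using meet[OF that] im that by simp
    show "f ` C v \<subseteq> {..<M}" if "v \<in> W" for v
      using image_mono[OF CX[OF that]] f(2) by (rule order_trans)
    show "f ` I v \<subseteq> {..<M}" for v
      using image_mono[OF IX] f(2) by (rule order_trans)
    show "f ` C v \<inter> f ` I v = {}" if "v \<in> W" for v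
      by (simp only: im[OF that] disj[OF that] image_empty)
  qed simp
  moreover have "card W = k ^ d" by (simp add: W_def card_PiE)
  ultimately show ?thesis by simp
qed

section \<open>The signed intervals\<close>

text \<open>
  The intervals are indexed by pairs: \<open>(0, p)\<close> is the cyclic interval at \<open>p\<close>, and \<open>(t, p)\<close> with
  \<open>t \<ge> 1\<close> is the leaf at which the two searches stop at \<open>t\<close> and \<open>p\<close>.
\<close>

definition cube_index :: "nat \<Rightarrow> (nat \<times> nat) set" where
  "cube_index r = {(t, p). t = 0 \<and> p < 2 * r - 1 \<or> 1 \<le> t \<and> t < r \<and> r \<le> p \<and> p < t + r}"

text \<open>For \<open>t = 0\<close>, the disjunct \<open>j + r \<le> p\<close> is the part of
  \<open>p + 1\<close>, ..., \<open>p + r - 1\<close> that wraps around modulo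
  \<open>2 * r - 1\<close>.\<close>

fun cube_zeros :: "nat \<Rightarrow> nat \<times> nat \<Rightarrow> nat set" where
  "cube_zeros r (t, p) =
     (if t = 0 then {j. j < 2 * r - 1 \<and> (p < j \<and> j < p + r \<or> j + r \<le> p)}
      else {t<..<r} \<union> {p<..<t + r})"

fun cube_ones :: "nat \<times> nat \<Rightarrow> nat set" where
  "cube_ones (t, p) = (if t = 0 then {p} else {t, p})"

lemma card_cube_index_le: "finite (cube_index r)" "card (cube_index r) \<le> 2 * r\<^sup>2"
proof -
  have sub: "cube_index r \<subseteq> {..<r} \<times> {..<2 * r}"
    by (auto simp: cube_index_def)
  then show "finite (cube_index r)" by (rule finite_subset) simp
  show "card (cube_index r) \<le> 2 * r\<^sup>2"
    using card_mono[OF _ sub] by (simp add: power2_eq_square)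
qed

text \<open>A leaf fixes \<open>r - t\<close> positions in the first search and
  \<open>t + r - p\<close> in the second, together \<open>2 * r - p\<close>, and
  \<open>r \<le> p\<close>.\<close>

lemma cube_codim:
  assumes "c \<in> cube_index r"
  shows "card (cube_zeros r c \<union> cube_ones c) \<le> r"
proof -
  obtain t p where c: "c = (t, p)" by force
  show ?thesis
  proof (cases "t = 0")
    case True
    then have p: "p < 2 * r - 1" using assms by (auto simp: c cube_index_def)
    show ?thesis
    proof (cases "p < r")
      case True
      then have "cube_zeros r c \<union> cube_ones c \<subseteq> {p..<p + r}"
        using \<open>t = 0\<close> by (auto simp: c)
      from card_mono[OF _ this] show ?thesis by simp
    next
      case False
      then have "cube_zeros r c \<union> cube_ones c \<subseteq> {p..<2 * r - 1} \<union> {..<Suc p - r}"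
        using \<open>t = 0\<close> p by (auto simp: c)
      from card_mono[OF _ this]
      have "card (cube_zeros r c \<union> cube_ones c) \<le> card ({p..<2 * r - 1} \<union> {..<Suc p - r})" by simp
      also have "\<dots> \<le> (2 * r - 1 - p) + (Suc p - r)"
        by (rule order_trans[OF card_Un_le]) simp
      finally show ?thesis using p False by linarith
    qed
  next
    case False
    then have tp: "1 \<le> t" "t < r" "r \<le> p" "p < t + r" using assms by (auto simp: c cube_index_def)
    then have "cube_zeros r c \<union> cube_ones c = {t..<r} \<union> {p..<t + r}"
      using False by (auto simp: c)
    then have "card (cube_zeros r c \<union> cube_ones c) \<le> (r - t) + (t + r - p)"
      using card_Un_le[of "{t..<r}" "{p..<t + r}"] by simp
    then show ?thesis using tp by linarith
  qed
qed

lemma cube_cover: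
  assumes "D \<subseteq> {..<2 * r - 1}" "D \<noteq> {}"
  shows "\<exists>c\<in>cube_index r. cube_ones c \<subseteq> D \<and> cube_zeros r c \<inter> D = {}"
proof -
  have fin: "finite D" using assms finite_subset by blast
  have D: "i < 2 * r - 1" if "i \<in> D" for i using assms that by blast
  show ?thesis
  proof (cases "D \<inter> {1..<r} = {}")
    case True
    \<comment> \<open>Without \<open>0\<close>, \<open>D\<close> starts at \<open>r\<close> or
      later, and the window after \<open>Max D\<close> meets only positions beyond
      \<open>Max D\<close> and, after wrapping, positions below \<open>r\<close>.\<close>
    define j where "j = (if 0 \<in> D then 0 else Max D)"
    have "j \<in> D" using Max_in[OF fin assms(2)] by (simp add: j_def)
    moreover have "i \<notin> cube_zeros r (0, j)" if "i \<in> D" for i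
    proof -
      have "i = 0 \<or> r \<le> i" using True that by force
      then show ?thesis using Max_ge[OF fin that] D[OF Max_in[OF fin assms(2)]] that
        by (auto simp: j_def split: if_splits)
    qed
    ultimately show ?thesis using D by (intro bexI[of _ "(0, j)"]) (auto simp: cube_index_def)
  next
    case False
    define t where "t = Max (D \<inter> {1..<r})"
    have t: "t \<in> D" "1 \<le> t" "t < r"
      using Max_in[of "D \<inter> {1..<r}"] False fin by (auto simp: t_def)
    have tmax: "i \<le> t" if "i \<in> D" "i < r" for i
      using that fin t Max_ge[of "D \<inter> {1..<r}" i] by (cases "i = 0") (auto simp: t_def)
    show ?thesis
    proof (cases "D \<inter> {r..<t + r} = {}")
      case True
      \<comment> \<open>The window after \<open>t\<close> does not wrap: below \<open>r\<close> it
        avoids \<open>D\<close> by maximality of \<open>t\<close>, from \<open>r\<close> on by the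
        failed search.\<close>
      have "i \<notin> cube_zeros r (0, t)" if "i \<in> D" for i
        using tmax[OF that] True that t by (cases "i < r") auto
      then show ?thesis using t D[OF t(1)]
        by (intro bexI[of _ "(0, t)"]) (auto simp: cube_index_def)
    next
      case False
      define p where "p = Max (D \<inter> {r..<t + r})"
      have p: "p \<in> D" "r \<le> p" "p < t + r"
        using Max_in[of "D \<inter> {r..<t + r}"] False fin by (auto simp: p_def)
      have pmax: "i \<le> p" if "i \<in> D" "i < t + r" for i
        using that fin p Max_ge[of "D \<inter> {r..<t + r}" i] by (cases "i < r") (auto simp: p_def)
      have "i \<notin> cube_zeros r (t, p)" if "i \<in> D" for i
        using tmax[OF that] pmax[OF that] t by auto
      then show ?thesis using t p
        by (intro bexI[of _ "(t, p)"]) (auto simp: cube_index_def)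
    qed
  qed
qed

text \<open>Of two positions on a cycle of length \<open>2 * r - 1\<close>, one follows the other
  within \<open>r - 1\<close> steps, so two cyclic intervals clash. Two leaves clash where their
  searches first diverge.\<close>

lemma cube_unambiguous:
  assumes "c \<in> cube_index r" "c' \<in> cube_index r" "c \<noteq> c'"
    and "cube_ones c \<union> cube_ones c' \<subseteq> D" "(cube_zeros r c \<union> cube_zeros r c') \<inter> D = {}"
  shows "snd c = snd c' \<and> (fst c = 0) \<noteq> (fst c' = 0)"
proof -
  obtain t p t' p' where c: "c = (t, p)" "c' = (t', p')" by fastforce
  have clash: "i \<notin> cube_zeros r b" if "i \<in> cube_ones a" "a \<in> {c, c'}" "b \<in> {c, c'}" for i a b
    using assms(4,5) that by blast
  \<comment> \<open>If \<open>q < s\<close> or \<open>s + r \<le> q\<close>, then \<open>s\<close>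
    is a zero of the cyclic interval; if \<open>q = s\<close> or \<open>r \<le> q < p\<close>, then
    \<open>p\<close> is. Any other \<open>q \<noteq> p\<close> is a zero of the leaf.\<close>
  have mixed: "q = p" if "(0, q) \<in> {c, c'}" "(s, p) \<in> {c, c'}" "s \<noteq> 0" for q s p
  proof -
    have "s \<in> cube_ones (s, p)" "p \<in> cube_ones (s, p)" "q \<in> cube_ones (0, q)"
      using \<open>s \<noteq> 0\<close> by auto
    then have "s \<notin> cube_zeros r (0, q)" "p \<notin> cube_zeros r (0, q)" "q \<notin> cube_zeros r (s, p)"
      using clash that(1,2) by blast+
    moreover have "(0, q) \<in> cube_index r" "(s, p) \<in> cube_index r" using assms that by auto
    ultimately show ?thesis using \<open>s \<noteq> 0\<close> by (auto simp: cube_index_def)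
  qed
  have ones: "p' \<notin> cube_zeros r c" "p \<notin> cube_zeros r c'"
    "t \<noteq> 0 \<Longrightarrow> t \<notin> cube_zeros r c'" "t' \<noteq> 0 \<Longrightarrow> t' \<notin> cube_zeros r c"
    using clash[of _ c c'] clash[of _ c' c] by (auto simp: c)
  consider "t = 0" "t' = 0" | "t \<noteq> 0" "t' \<noteq> 0" | "t = 0" "t' \<noteq> 0" | "t \<noteq> 0" "t' = 0" by blast
  then show ?thesis
  proof cases
    case 1
    then have "p = p'" using ones assms(1,2) by (auto simp: c cube_index_def)
    then show ?thesis using 1 assms(3) by (simp add: c)
  next
    case 2
    then have "t = t'" using ones assms(1,2) by (auto simp: c cube_index_def)
    moreover from this have "p = p'" using 2 ones assms(1,2) by (auto simp: c cube_index_def)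
    ultimately show ?thesis using assms(3) by (simp add: c)
  next
    case 3
    then show ?thesis using mixed[of p t' p'] by (simp add: c)
  next
    case 4
    then show ?thesis using mixed[of p' t p] by (simp add: c)
  qed
qed

section \<open>Choice of parameters and asymptotics\<close>

lemma graph_with_large_cover_number:
  assumes "0 < k"
  shows "\<exists>E. fin_sgraph {..<2 * r\<^sup>2 * k ^ r} E
    \<and> k ^ (2 * r - 1) \<le> cis_cover_number {..<2 * r\<^sup>2 * k ^ r} E"
proof (rule cis_cover_number_ge_signed_cubes[where label = snd and pos = "\<lambda>c. fst c = 0"])
  show "cube_zeros r c \<union> cube_ones c \<subseteq> {..<2 * r - 1}" if "c \<in> cube_index r" for c
    using that by (cases c) (auto simp: cube_index_def)
  show "snd c \<in> cube_ones c" for c by (cases c) auto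
  show "card (cube_index r) * k ^ r \<le> 2 * r\<^sup>2 * k ^ r"
    by (intro mult_right_mono card_cube_index_le) simp
qed (fact card_cube_index_le cube_codim cube_cover cube_unambiguous assms)+

theorem theorem3:
  shows "\<exists>(V :: nat \<Rightarrow> nat set) (E :: nat \<Rightarrow> nat set set) (\<epsilon> :: nat \<Rightarrow> real).
    (\<forall>t. fin_sgraph (V t) (E t)) \<and>
    filterlim (\<lambda>t. card (V t)) at_top sequentially \<and>
    \<epsilon> \<longlonglongrightarrow> 0 \<and>
    (\<forall>t. cis_nondet_cc (V t) (E t) \<ge> (2 - \<epsilon> t) * log 2 (real (card (V t))))"
proof -
  \<comment> \<open>With \<open>r = t + 1\<close> and \<open>k = 2 ^ r\<close>, the bound has
    logarithm \<open>(2 * r - 1) * r\<close>, while that of the vertex count is \<open>r ^ 2\<close>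
    plus O(log r); the ratio tends to 2.\<close>
  define M where "M t = 2 * (Suc t)\<^sup>2 * (2 ^ Suc t) ^ Suc t" for t :: nat
  define b where "b t = log 2 (real (M t))" for t
  define a where "a t = real ((2 * t + 1) * Suc t)" for t :: nat
  define \<epsilon> where "\<epsilon> t = 2 - a t / b t" for t
  have "\<exists>E. fin_sgraph {..<M t} E \<and> (2 ^ Suc t) ^ (2 * t + 1) \<le> cis_cover_number {..<M t} E" for t
    using graph_with_large_cover_number[of "2 ^ Suc t" "Suc t"] by (simp add: M_def)
  then obtain E where E: "\<And>t. fin_sgraph {..<M t} (E t)"
    and large: "\<And>t. (2 ^ Suc t) ^ (2 * t + 1) \<le> cis_cover_number {..<M t} (E t)" by metis
  have b: "b t = 1 + 2 * log 2 (real t + 1) + (real t + 1)\<^sup>2" for t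
  proof -
    have "real (M t) = 2 * (real t + 1)\<^sup>2 * 2 ^ (Suc t * Suc t)"
      by (simp add: M_def power_mult add.commute del: power_Suc mult_Suc mult_Suc_right)
    then have "b t = log 2 2 + log 2 ((real t + 1)\<^sup>2) + log 2 (2 ^ (Suc t * Suc t))"
      unfolding b_def by (simp add: log_mult del: power_Suc mult_Suc mult_Suc_right)
    also have "\<dots> = 1 + 2 * log 2 (real t + 1) + real (Suc t * Suc t)"
      by (simp add: log_nat_power del: power_Suc mult_Suc mult_Suc_right)
    finally show ?thesis by (simp add: power2_eq_square algebra_simps)
  qed
  have bpos: "b t > 0" for t
    unfolding b by (intro add_pos_nonneg) auto
  have "M t \<ge> t" for t
  proof -
    have "t \<le> (Suc t)\<^sup>2 * 1" by (simp add: power2_eq_square)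
    also have "\<dots> \<le> (Suc t)\<^sup>2 * (2 * (2 ^ Suc t) ^ Suc t)" by (intro mult_left_mono) auto
    finally show ?thesis by (simp add: M_def mult.assoc mult.left_commute del: power_Suc)
  qed
  then have "filterlim M at_top sequentially"
    by (intro filterlim_at_top_mono[OF filterlim_ident]) auto
  moreover have "\<epsilon> \<longlonglongrightarrow> 0"
    unfolding \<epsilon>_def b a_def by real_asymp
  moreover have "cis_nondet_cc {..<M t} (E t) \<ge> (2 - \<epsilon> t) * log 2 (real (M t))" for t
  proof -
    have "(2 - \<epsilon> t) * log 2 (real (M t)) = a t"
      using bpos[of t] by (simp add: \<epsilon>_def b_def[symmetric])
    also have "\<dots> = log 2 (real ((2 ^ Suc t) ^ (2 * t + 1)))"
      by (simp add: a_def log_nat_power power_mult[symmetric] mult.commute del: power_Suc)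
    also have "\<dots> \<le> log 2 (real (cis_cover_number {..<M t} (E t)))"
    proof (rule log_mono)
      show "real ((2 ^ Suc t) ^ (2 * t + 1)) \<le> real (cis_cover_number {..<M t} (E t))"
        using large[of t] of_nat_le_iff by blast
    qed auto
    finally show ?thesis by (simp add: cis_nondet_cc_def)
  qed
  ultimately show ?thesis
    using E by (intro exI[of _ "\<lambda>t. {..<M t}"] exI[of _ E] exI[of _ \<epsilon>]) simp
qed

end
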